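(* Suppose the sequence $(\mu_1,x_1),(\mu_2,x_2),\ldots$ is generated by Algorithm QN2 (defined in the context) started with $(\mu_0,x_0)$, and suppose the sequence converges to the eigenpair $(\lambda,v)$, where $c^Hv=1$. Let $\sigma=\mu_0$, $w_\sigma^H=c^HM(\sigma)^{-1}$, and assume $w_\sigma^HM'(\lambda)v\neq0$. Then the sequence satisfies $$\begin{bmatrix} x_{k+1}-v\\ \mu_{k+1}-\lambda\end{bmatrix}=A_2\begin{bmatrix} x_k-v\\ \mu_k-\lambda\end{bmatrix}+\mathcal{O}\left(\left\|\begin{bmatrix} x_k-v\\ \mu_k-\lambda\end{bmatrix}\right\|^2\right)\qquad (k\to\infty),$$ where $$A_2=\begin{bmatrix} (I-\alpha qc^H)M(\sigma)^{-1}\left[M(\sigma)-M(\lambda)\right] & 0\\ \alpha c^HM(\sigma)^{-1}\left(M(\sigma)-M(\lambda)\right) & 0\end{bmatrix},$$ with $\alpha:=(w_\sigma^HM'(\lambda)v)^{-1}$ and $q:=M(\sigma)^{-1}M'(\lambda)v$.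
   Context: $\Omega\subset\mathbb{C}$ is a closed set, and $M:\Omega\to\mathbb{C}^{n\times n}$ is analytic (holomorphic) in $\Omega$. An eigenpair is $(\lambda,v)$ with $\lambda\in\Omega$, $v\ne0$, $M(\lambda)v=0$. The vector $c\in\mathbb{C}^n$ is a fixed normalization vector, and eigenpairs are normalized by $c^Hv=1$, i.e. $(v,\lambda)$ solves $M(\lambda)v=0$, $c^Hv-1=0$. The superscript $H$ denotes conjugate transpose. Algorithm QN2: given $(\mu_0,x_0)\in\mathbb{C}\times\mathbb{C}^n$, set $\sigma=\mu_0$ (with $M(\sigma)$ assumed invertible) and $w_\sigma^H=c^HM(\sigma)^{-1}$. For $k=0,1,2,\dots$ compute $$\Delta\mu_k=-\frac{w_\sigma^HM(\mu_k)x_k}{w_\sigma^HM'(\mu_k)x_k},\quad z_k=\Delta\mu_kM'(\mu_k)x_k+M(\mu_k)x_k,\quad \mu_{k+1}=\mu_k+\Delta\mu_k,\quad x_{k+1}=x_k-M(\sigma)^{-1}z_k$$ (the denominators are assumed nonzero). For normalized iterates ($c^Hx_k=1$) this is the quasi-Newton iteration for the system $M(\mu)x=0$, $c^Hx-1=0$ in which the Jacobian is replaced by $\begin{bmatrix}M(\sigma)&M'(\mu_k)x_k\\ c^H&0\end{bmatrix}$. *)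

theory Defs
  imports "HOL-Analysis.Analysis" "HOL-Library.Landau_Symbols"
begin

text \<open>
  A row vector is represented by the vector of its entries; \<open>scalar_product\<close> (which does
  not conjugate) is the product of a row with a column and \<open>v*\<close> that of a row with a matrix.
\<close>

definition conj_trans :: "complex ^ 'n \<Rightarrow> complex ^ 'n" ("_\<^sup>H" [1000] 1000) where
  "c\<^sup>H = (\<chi> i. cnj (c $ i))"

definition outer_prod :: "complex ^ 'n \<Rightarrow> complex ^ 'm \<Rightarrow> complex ^ 'm ^ 'n" where
  "outer_prod p r = (\<chi> i j. p $ i * r $ j)"

text \<open>
  For a set that is not open, \<open>analytic_on\<close> means holomorphic in a neighbourhood of each of
  its points, so the derivative below is meaningful at every point of the set.
\<close>

definition matrix_analytic_on :: "(complex \<Rightarrow> complex ^ 'n ^ 'm) \<Rightarrow> complex set \<Rightarrow> bool" where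
  "matrix_analytic_on M \<Omega> \<longleftrightarrow> (\<forall>i j. (\<lambda>z. M z $ i $ j) analytic_on \<Omega>)"

definition matrix_deriv :: "(complex \<Rightarrow> complex ^ 'n ^ 'm) \<Rightarrow> complex \<Rightarrow> complex ^ 'n ^ 'm" where
  "matrix_deriv M z = (\<chi> i j. deriv (\<lambda>w. M w $ i $ j) z)"

definition is_eigenpair ::
    "complex set \<Rightarrow> (complex \<Rightarrow> complex ^ 'n ^ 'n) \<Rightarrow> complex \<Rightarrow> complex ^ 'n \<Rightarrow> bool" where
  "is_eigenpair \<Omega> M l v \<longleftrightarrow> l \<in> \<Omega> \<and> v \<noteq> 0 \<and> M l *v v = 0"

text \<open>The row vector \<open>w\<^sub>\<sigma>\<^sup>H = c\<^sup>H M(\<sigma>)\<^sup>-\<^sup>1\<close>:\<close>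

definition qn2_row :: "(complex \<Rightarrow> complex ^ 'n ^ 'n) \<Rightarrow> complex ^ 'n \<Rightarrow> complex \<Rightarrow> complex ^ 'n" where
  "qn2_row M c \<sigma> = c\<^sup>H v* matrix_inv (M \<sigma>)"

definition qn2_dmu ::
    "(complex \<Rightarrow> complex ^ 'n ^ 'n) \<Rightarrow> complex ^ 'n \<Rightarrow> complex \<Rightarrow> complex \<Rightarrow> complex ^ 'n \<Rightarrow> complex" where
  "qn2_dmu M c \<sigma> m y =
     - (scalar_product (qn2_row M c \<sigma>) (M m *v y) /
        scalar_product (qn2_row M c \<sigma>) (matrix_deriv M m *v y))"

definition qn2_z ::
    "(complex \<Rightarrow> complex ^ 'n ^ 'n) \<Rightarrow> complex ^ 'n \<Rightarrow> complex \<Rightarrow> complex \<Rightarrow> complex ^ 'n \<Rightarrow> complex ^ 'n" where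
  "qn2_z M c \<sigma> m y = qn2_dmu M c \<sigma> m y *s (matrix_deriv M m *v y) + M m *v y"

text \<open>
  The iterates \<open>(\<mu> k, x k)\<close> are those of the algorithm started with \<open>(\<mu> 0, x 0)\<close> and shift
  \<open>\<sigma> = \<mu> 0\<close>. That the algorithm can be carried out is part of the definition: the
  iterates \<open>\<mu> k\<close> lie in the domain \<open>\<Omega>\<close> of \<open>M\<close>, \<open>M(\<sigma>)\<close> is invertible, and no denominator
  vanishes.
\<close>

definition qn2_sequence ::
    "complex set \<Rightarrow> (complex \<Rightarrow> complex ^ 'n ^ 'n) \<Rightarrow> complex ^ 'n \<Rightarrow>
     (nat \<Rightarrow> complex) \<Rightarrow> (nat \<Rightarrow> complex ^ 'n) \<Rightarrow> bool" where
  "qn2_sequence \<Omega> M c \<mu> x \<longleftrightarrow>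
     invertible (M (\<mu> 0)) \<and>
     (\<forall>k. \<mu> k \<in> \<Omega> \<and>
          scalar_product (qn2_row M c (\<mu> 0)) (matrix_deriv M (\<mu> k) *v x k) \<noteq> 0 \<and>
          \<mu> (Suc k) = \<mu> k + qn2_dmu M c (\<mu> 0) (\<mu> k) (x k) \<and>
          x (Suc k) = x k - matrix_inv (M (\<mu> 0)) *v qn2_z M c (\<mu> 0) (\<mu> k) (x k))"

text \<open>Vectors of length \<open>n + 1\<close> and matrices of size \<open>(n + 1) \<times> (n + 1)\<close> in block form; the
  index type \<open>'n + 1\<close> is the disjoint sum of \<open>'n\<close> and a one-element type.\<close>

definition block_vec :: "complex ^ 'n \<Rightarrow> complex \<Rightarrow> complex ^ ('n + 1)" where
  "block_vec y m = (\<chi> i. case i of Inl a \<Rightarrow> y $ a | Inr _ \<Rightarrow> m)"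

definition block_mat ::
    "complex ^ 'n ^ 'n \<Rightarrow> complex ^ 'n \<Rightarrow> complex ^ 'n \<Rightarrow> complex \<Rightarrow> complex ^ ('n + 1) ^ ('n + 1)" where
  "block_mat B b r d =
     (\<chi> i j. case i of
        Inl a \<Rightarrow> (case j of Inl a' \<Rightarrow> B $ a $ a' | Inr _ \<Rightarrow> b $ a)
      | Inr _ \<Rightarrow> (case j of Inl a' \<Rightarrow> r $ a' | Inr _ \<Rightarrow> d))"

lemma block_mat_mult_block_vec:
  "block_mat B b r d *v block_vec y m = block_vec (B *v y + m *s b) (scalar_product r y + d * m)"
proof -
  have S: "(\<Sum>j\<in>UNIV. f j) = (\<Sum>a\<in>UNIV. f (Inl a)) + f (Inr 1)" for f :: "'a + 1 \<Rightarrow> complex"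
    by (subst UNIV_Plus_UNIV[symmetric], subst sum.Plus) (simp_all add: UNIV_1)
  show ?thesis
    by (simp add: vec_eq_iff block_mat_def block_vec_def matrix_vector_mult_def
        scalar_product_def S mult.commute split: sum.split)
qed

end

theory Submission
  imports Defs "HOL-Complex_Analysis.Cauchy_Integral_Formula"
begin

text \<open>
  Write \<open>e\<^sub>k = x\<^sub>k - v\<close>, \<open>d\<^sub>k = \<mu>\<^sub>k - l\<close>, \<open>a = M'(l) v\<close>, and call a quantity of second order if it
  is \<open>O(\<parallel>(e\<^sub>k, d\<^sub>k)\<parallel>\<^sup>2)\<close>.

  Since \<open>w\<^sub>\<sigma>\<^sup>H z\<^sub>k = 0\<close> by the choice of \<open>\<Delta>\<mu>\<^sub>k\<close>, the iteration preserves \<open>c\<^sup>H x\<^sub>k\<close>; its constant value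
  must be that of the limit, so \<open>c\<^sup>H e\<^sub>k = 0\<close> for every \<open>k\<close>
  (\<open>qn2_sequence_normalization\<close>). This is why no term \<open>\<alpha> c\<^sup>H e\<^sub>k\<close> survives: on the
  errors, the lower left block \<open>\<alpha> c\<^sup>H M(\<sigma>)\<^sup>-\<^sup>1 (M(\<sigma>) - M(l))\<close> of \<open>A2\<close> acts as
  \<open>- \<alpha> w\<^sub>\<sigma>\<^sup>H M(l)\<close>.

  Since \<open>M(l) v = 0\<close>, Taylor expansion at \<open>l\<close> (\<open>analytic_taylor_remainder_bigo\<close>) gives
  \<open>M(\<mu>\<^sub>k) x\<^sub>k = M(l) e\<^sub>k + d\<^sub>k a + R\<^sub>k\<close> and \<open>M'(\<mu>\<^sub>k) x\<^sub>k = a + D\<^sub>k\<close>, where \<open>R\<^sub>k\<close> is of second order and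
  \<open>D\<^sub>k\<close> of first order. The denominator of \<open>\<Delta>\<mu>\<^sub>k\<close> tends to \<open>w\<^sub>\<sigma>\<^sup>H a = 1/\<alpha>\<close>, which is nonzero,
  so \<open>\<Delta>\<mu>\<^sub>k = - d\<^sub>k - \<alpha> w\<^sub>\<sigma>\<^sup>H M(l) e\<^sub>k + \<delta>\<^sub>k\<close> with \<open>\<delta>\<^sub>k\<close> of second order. The eigenvalue error thus
  loses its dependence on \<open>d\<^sub>k\<close>, and in \<open>z\<^sub>k\<close> the two terms \<open>\<plusminus>d\<^sub>k a\<close> cancel as well, which
  explains the zero column of \<open>A2\<close>. Precisely, the remainder in the theorem is the block vector
  with the entries \<open>- M(\<sigma>)\<^sup>-\<^sup>1 (\<Delta>\<mu>\<^sub>k D\<^sub>k + \<delta>\<^sub>k a + R\<^sub>k)\<close> and \<open>\<delta>\<^sub>k\<close>, all of whose terms are of second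
  order.
\<close>

section \<open>Order estimates for vectors and analytic functions\<close>

lemma norm_vec_bigoI:
  fixes u :: "'b \<Rightarrow> complex ^ 'n" and g :: "'b \<Rightarrow> real"
  assumes "\<And>i. (\<lambda>k. norm (u k $ i)) \<in> O[F](g)"
  shows "(\<lambda>k. norm (u k)) \<in> O[F](g)"
proof (rule landau_o.big_trans)
  show "(\<lambda>k. norm (u k)) \<in> O[F](\<lambda>k. \<Sum>i\<in>UNIV. norm (u k $ i))"
    by (rule bigoI[of _ 1]) (auto simp: norm_vec_def L2_set_le_sum sum_nonneg)
  show "(\<lambda>k. \<Sum>i\<in>UNIV. norm (u k $ i)) \<in> O[F](g)"
    by (intro big_sum_in_bigo assms)
qed

lemma norm_nth_bigo:
  fixes u :: "'b \<Rightarrow> complex ^ 'n" and g :: "'b \<Rightarrow> real"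
  assumes "(\<lambda>k. norm (u k)) \<in> O[F](g)"
  shows "(\<lambda>k. norm (u k $ i)) \<in> O[F](g)"
  by (rule landau_o.big_trans[OF _ assms], rule bigoI[of _ 1]) (simp add: Finite_Cartesian_Product.norm_nth_le)

lemma norm_add_bigo:
  fixes u w :: "'b \<Rightarrow> 'c::real_normed_vector" and g :: "'b \<Rightarrow> real"
  assumes "(\<lambda>k. norm (u k)) \<in> O[F](g)" "(\<lambda>k. norm (w k)) \<in> O[F](g)"
  shows "(\<lambda>k. norm (u k + w k)) \<in> O[F](g)"
  by (rule landau_o.big_trans[OF _ sum_in_bigo(1)[OF assms]], rule bigoI[of _ 1])
     (simp add: norm_triangle_ineq)

lemma norm_diff_bigo:
  fixes u w :: "'b \<Rightarrow> 'c::real_normed_vector" and g :: "'b \<Rightarrow> real"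
  assumes "(\<lambda>k. norm (u k)) \<in> O[F](g)" "(\<lambda>k. norm (w k)) \<in> O[F](g)"
  shows "(\<lambda>k. norm (u k - w k)) \<in> O[F](g)"
  using norm_add_bigo[of u F g "\<lambda>k. - w k"] assms by simp

lemma scalar_product_bigo:
  fixes r y :: "'b \<Rightarrow> complex ^ 'n" and f g :: "'b \<Rightarrow> real"
  assumes "(\<lambda>k. norm (r k)) \<in> O[F](f)" "(\<lambda>k. norm (y k)) \<in> O[F](g)"
  shows "(\<lambda>k. norm (scalar_product (r k) (y k))) \<in> O[F](\<lambda>k. f k * g k)"
proof (rule landau_o.big_trans)
  show "(\<lambda>k. norm (scalar_product (r k) (y k)))
          \<in> O[F](\<lambda>k. \<Sum>i\<in>UNIV. norm (r k $ i) * norm (y k $ i))"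
    by (rule bigoI[of _ 1])
       (simp add: scalar_product_def norm_mult[symmetric] sum_nonneg norm_sum)
  show "(\<lambda>k. \<Sum>i\<in>UNIV. norm (r k $ i) * norm (y k $ i)) \<in> O[F](\<lambda>k. f k * g k)"
    by (intro big_sum_in_bigo landau_o.big.mult norm_nth_bigo assms)
qed

lemma matrix_vector_mult_bigo:
  fixes A :: "'b \<Rightarrow> complex ^ 'n ^ 'm" and y :: "'b \<Rightarrow> complex ^ 'n" and f g :: "'b \<Rightarrow> real"
  assumes A: "\<And>i j. (\<lambda>k. norm (A k $ i $ j)) \<in> O[F](f)"
    and y: "(\<lambda>k. norm (y k)) \<in> O[F](g)"
  shows "(\<lambda>k. norm (A k *v y k)) \<in> O[F](\<lambda>k. f k * g k)"
proof (rule norm_vec_bigoI)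
  fix i
  have "(A k *v y k) $ i = scalar_product (A k $ i) (y k)" for k
    by (simp add: matrix_vector_mult_def scalar_product_def)
  then show "(\<lambda>k. norm ((A k *v y k) $ i)) \<in> O[F](\<lambda>k. f k * g k)"
    using scalar_product_bigo[OF norm_vec_bigoI[OF A] y] by simp
qed

lemma scalar_mult_bigo:
  fixes a :: "'b \<Rightarrow> complex" and y :: "'b \<Rightarrow> complex ^ 'n" and f g :: "'b \<Rightarrow> real"
  assumes "(\<lambda>k. norm (a k)) \<in> O[F](f)" "(\<lambda>k. norm (y k)) \<in> O[F](g)"
  shows "(\<lambda>k. norm (a k *s y k)) \<in> O[F](\<lambda>k. f k * g k)"
proof (rule norm_vec_bigoI)
  fix i
  show "(\<lambda>k. norm ((a k *s y k) $ i)) \<in> O[F](\<lambda>k. f k * g k)"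
    using landau_o.big.mult[OF assms(1) norm_nth_bigo[OF assms(2), of i]]
    by (simp add: norm_mult)
qed

text \<open>
  The filter \<open>nhds l\<close> rather than \<open>at l\<close> admits \<open>z = l\<close>, so that the bounds can be composed with
  any sequence converging to \<open>l\<close>, including one that takes the value \<open>l\<close>.
\<close>

lemma analytic_increment_bigo:
  assumes "f analytic_on {l}"
  shows "(\<lambda>z. f z - f l) \<in> O[nhds l](\<lambda>z. z - l)"
proof -
  have "((\<lambda>z. (f z - f l) / (z - l)) \<longlongrightarrow> deriv f l) (at l)"
    using analytic_derivI[OF assms, of UNIV] by (simp add: has_field_derivative_iff)
  then have "(\<lambda>z. f z - f l) \<in> O[at l](\<lambda>z. z - l)"
    by (rule bigoI_tendsto) (auto simp: eventually_at_filter)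
  then obtain C where "\<forall>\<^sub>F z in at l. norm (f z - f l) \<le> C * norm (z - l)"
    by (elim landau_o.bigE)
  then have "\<forall>\<^sub>F z in nhds l. norm (f z - f l) \<le> C * norm (z - l)"
    unfolding eventually_at_filter by (rule eventually_mono) auto
  then show ?thesis by (rule bigoI)
qed

text \<open>
  The difference quotient of \<open>f\<close> at \<open>l\<close>, with the value \<open>f'(l)\<close> at \<open>l\<close>, is itself analytic.
  The remainder is \<open>z - l\<close> times the increment of this quotient, so the first-order bound applied
  to the quotient yields the second order.
\<close>

lemma analytic_taylor_remainder_bigo:
  assumes "f analytic_on {l}"
  shows "(\<lambda>z. f z - f l - deriv f l * (z - l)) \<in> O[nhds l](\<lambda>z. (z - l)\<^sup>2)"
proof -
  define g where "g = (\<lambda>z. if z = l then deriv f l else (f z - f l) / (z - l))"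
  obtain S where S: "open S" "l \<in> S" "f holomorphic_on S"
    using assms by (auto simp: analytic_at)
  have "g analytic_on {l}"
    unfolding analytic_at g_def using S pole_lemma_open by blast
  then have "(\<lambda>z. (z - l) * (g z - g l)) \<in> O[nhds l](\<lambda>z. (z - l) * (z - l))"
    by (intro landau_o.big.mult analytic_increment_bigo landau_o.big_refl)
  moreover have "(z - l) * (g z - g l) = f z - f l - deriv f l * (z - l)" for z
    by (simp add: g_def field_simps)
  ultimately show ?thesis by (simp add: power2_eq_square)
qed

section \<open>Products of rows, matrices and columns\<close>

lemma scalar_product_add: "scalar_product r (y + z) = scalar_product r y + scalar_product r z"
  for r :: "complex ^ 'n"
  by (simp add: scalar_product_def sum.distrib algebra_simps)

lemma scalar_product_diff: "scalar_product r (y - z) = scalar_product r y - scalar_product r z"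
  for r :: "complex ^ 'n"
  by (simp add: scalar_product_def sum_subtractf algebra_simps)

lemma scalar_product_scale: "scalar_product r (a *s y) = a * scalar_product r y"
  for r :: "complex ^ 'n"
  by (simp add: scalar_product_def sum_distrib_left algebra_simps)

lemma scalar_product_scale_left: "scalar_product (a *s r) y = a * scalar_product r y"
  for r :: "complex ^ 'n"
  by (simp add: scalar_product_def sum_distrib_left algebra_simps)

lemma scalar_product_vector_matrix_mult: "scalar_product (r v* A) y = scalar_product r (A *v y)"
  for r :: "complex ^ 'n" and A :: "complex ^ 'm ^ 'n"
  unfolding scalar_product_def vector_matrix_mult_def matrix_vector_mult_def
  by (simp add: sum_distrib_left sum_distrib_right mult_ac) (rule sum.swap)

lemma outer_prod_mult: "outer_prod p r *v y = scalar_product r y *s p"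
  by (simp add: vec_eq_iff outer_prod_def matrix_vector_mult_def scalar_product_def
      sum_distrib_left sum_distrib_right mult_ac)

lemma matrix_inv_mult_left:
  fixes A :: "complex ^ 'n ^ 'n"
  assumes "invertible A"
  shows "matrix_inv A ** A = mat 1"
  using someI_ex[OF assms[unfolded invertible_def]] by (simp add: matrix_inv_def)

lemma norm_le_norm_block_vec:
  shows "norm y \<le> norm (block_vec y m)" and "norm m \<le> norm (block_vec y m)"
    and "norm (block_vec y m) \<le> norm y + norm m"
proof -
  have S: "(\<Sum>j\<in>UNIV. f j) = (\<Sum>a\<in>UNIV. f (Inl a)) + f (Inr 1)" for f :: "'a + 1 \<Rightarrow> real"
    by (subst UNIV_Plus_UNIV[symmetric], subst sum.Plus) (simp_all add: UNIV_1)
  have eq: "norm (block_vec y m) = sqrt ((norm y)\<^sup>2 + (norm m)\<^sup>2)"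
    by (simp add: norm_vec_def L2_set_def block_vec_def S sum_nonneg)
  show "norm y \<le> norm (block_vec y m)" "norm m \<le> norm (block_vec y m)"
    unfolding eq by (auto intro: real_le_rsqrt)
  show "norm (block_vec y m) \<le> norm y + norm m"
    unfolding eq by (rule sqrt_sum_squares_le_sum) auto
qed

lemma block_vec_diff: "block_vec y m - block_vec z n = block_vec (y - z) (m - n)"
  by (simp add: vec_eq_iff block_vec_def split: sum.split)

section \<open>Quasi-Newton iteration with fixed shift\<close>

text \<open>
  The correction \<open>\<Delta>\<mu>\<^sub>k\<close> is the Newton step for which \<open>w\<^sub>\<sigma>\<^sup>H z\<^sub>k = 0\<close>, and \<open>w\<^sub>\<sigma>\<^sup>H z\<^sub>k\<close> is exactly the
  change of \<open>c\<^sup>H x\<^sub>k\<close> up to sign.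
\<close>

lemma qn2_sequence_normalization_const:
  assumes "qn2_sequence \<Omega> M c \<mu> x"
  shows "scalar_product (c\<^sup>H) (x k) = scalar_product (c\<^sup>H) (x 0)"
proof (induction k)
  case (Suc k)
  have nz: "scalar_product (qn2_row M c (\<mu> 0)) (matrix_deriv M (\<mu> k) *v x k) \<noteq> 0"
    and step: "x (Suc k) = x k - matrix_inv (M (\<mu> 0)) *v qn2_z M c (\<mu> 0) (\<mu> k) (x k)"
    using assms by (auto simp: qn2_sequence_def)
  have "scalar_product (c\<^sup>H) (matrix_inv (M (\<mu> 0)) *v qn2_z M c (\<mu> 0) (\<mu> k) (x k))
      = scalar_product (qn2_row M c (\<mu> 0)) (qn2_z M c (\<mu> 0) (\<mu> k) (x k))"
    by (simp add: qn2_row_def scalar_product_vector_matrix_mult)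
  also have "\<dots> = 0"
    using nz by (simp add: qn2_z_def scalar_product_add scalar_product_diff
        scalar_product_scale qn2_dmu_def)
  finally show ?case
    by (simp add: step scalar_product_diff Suc.IH)
qed simp

lemma qn2_sequence_normalization:
  assumes seq: "qn2_sequence \<Omega> M c \<mu> x" and lim: "x \<longlonglongrightarrow> v"
  shows "scalar_product (c\<^sup>H) (x k) = scalar_product (c\<^sup>H) v"
proof -
  have "(\<lambda>k. scalar_product (c\<^sup>H) (x k)) \<longlonglongrightarrow> scalar_product (c\<^sup>H) v"
    unfolding scalar_product_def by (intro tendsto_intros lim)
  moreover have "(\<lambda>k. scalar_product (c\<^sup>H) (x k)) = (\<lambda>_. scalar_product (c\<^sup>H) (x 0))"
    using qn2_sequence_normalization_const[OF seq] by blast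
  ultimately have "scalar_product (c\<^sup>H) v = scalar_product (c\<^sup>H) (x 0)"
    by (metis LIMSEQ_unique tendsto_const)
  then show ?thesis using qn2_sequence_normalization_const[OF seq] by simp
qed

theorem theorem3p2:
  fixes \<Omega> :: "complex set"
    and M :: "complex \<Rightarrow> complex ^ 'n ^ 'n"
    and c v q :: "complex ^ 'n"
    and \<mu> :: "nat \<Rightarrow> complex"
    and x :: "nat \<Rightarrow> complex ^ 'n"
    and l \<sigma> \<alpha> :: complex
    and A2 :: "complex ^ ('n + 1) ^ ('n + 1)"
  assumes "closed \<Omega>"
    and "matrix_analytic_on M \<Omega>"
    and "is_eigenpair \<Omega> M l v"
    and "scalar_product (c\<^sup>H) v = 1"
    and "qn2_sequence \<Omega> M c \<mu> x"
    and "(\<lambda>k. (\<mu> k, x k)) \<longlonglongrightarrow> (l, v)"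
    and "\<sigma> = \<mu> 0"
    and "scalar_product (qn2_row M c \<sigma>) (matrix_deriv M l *v v) \<noteq> 0"
    and "\<alpha> = inverse (scalar_product (qn2_row M c \<sigma>) (matrix_deriv M l *v v))"
    and "q = matrix_inv (M \<sigma>) *v (matrix_deriv M l *v v)"
    and "A2 = block_mat
           ((mat 1 - outer_prod (\<alpha> *s q) (c\<^sup>H)) ** matrix_inv (M \<sigma>) ** (M \<sigma> - M l)) 0
           (\<alpha> *s (c\<^sup>H v* matrix_inv (M \<sigma>) v* (M \<sigma> - M l))) 0"
  shows "(\<lambda>k. norm (block_vec (x (Suc k) - v) (\<mu> (Suc k) - l)
                    - A2 *v block_vec (x k - v) (\<mu> k - l)))
           \<in> O(\<lambda>k. (norm (block_vec (x k - v) (\<mu> k - l)))\<^sup>2)"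
proof -
  define w where "w = qn2_row M c \<sigma>"
  define N where "N = matrix_inv (M \<sigma>)"
  define a where "a = matrix_deriv M l *v v"
  define e where "e = (\<lambda>k. x k - v)"
  define d where "d = (\<lambda>k. \<mu> k - l)"
  define E where "E = (\<lambda>k. norm (block_vec (e k) (d k)))"
  define R where "R = (\<lambda>k. M (\<mu> k) *v x k - M l *v e k - d k *s a)"
  define D where "D = (\<lambda>k. matrix_deriv M (\<mu> k) *v x k - a)"
  define h where "h = (\<lambda>k. scalar_product w (matrix_deriv M (\<mu> k) *v x k))"
  \<comment> \<open>The deviation of the eigenvalue error from \<open>- \<alpha> w\<^sub>\<sigma>\<^sup>H M(l) e\<close>, its expected linear part.\<close>
  define \<delta> where "\<delta> = (\<lambda>k. d (Suc k) + \<alpha> * scalar_product w (M l *v e k))"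
  have ent: "(\<lambda>z. M z $ i $ j) analytic_on {l}" for i j
    using assms(2,3) unfolding matrix_analytic_on_def is_eigenpair_def
    by (meson analytic_on_subset empty_subsetI insert_subset)
  have eig: "M l *v v = 0" using assms(3) by (simp add: is_eigenpair_def)
  have lim_mu: "\<mu> \<longlonglongrightarrow> l" and lim_x: "x \<longlonglongrightarrow> v"
    using tendsto_fst[OF assms(6)] tendsto_snd[OF assms(6)] by simp_all
  have inv: "N ** M \<sigma> = mat 1"
    using assms(5,7) unfolding N_def qn2_sequence_def by (auto intro: matrix_inv_mult_left)
  have wN: "scalar_product w y = scalar_product (c\<^sup>H) (N *v y)" for y
    by (simp add: w_def qn2_row_def N_def scalar_product_vector_matrix_mult)
  have ce: "scalar_product (c\<^sup>H) (e k) = 0" for k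
    using qn2_sequence_normalization[OF assms(5) lim_x] by (simp add: e_def scalar_product_diff)
  have \<alpha>: "\<alpha> * scalar_product w a = 1" "\<alpha> \<noteq> 0"
    using assms(8,9) by (simp_all add: w_def a_def)

  have eE: "(\<lambda>k. norm (e k)) \<in> O(E)" and dE: "(\<lambda>k. norm (d k)) \<in> O(E)"
    unfolding E_def by (auto intro!: bigoI[of _ 1] simp: norm_le_norm_block_vec)
  have E0: "E \<longlonglongrightarrow> 0"
  proof (rule tendsto_sandwich[OF _ _ tendsto_const])
    show "(\<lambda>k. norm (e k) + norm (d k)) \<longlonglongrightarrow> 0"
      unfolding e_def d_def
      using tendsto_add[OF tendsto_norm[OF LIM_zero[OF lim_x]] tendsto_norm[OF LIM_zero[OF lim_mu]]]
      by simp
  qed (auto simp: E_def norm_le_norm_block_vec)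
  then have E1: "E \<in> O(\<lambda>_. 1)"
    by (intro bigoI_tendsto[of _ _ 0]) auto

  have incr: "(\<lambda>k. norm (f (\<mu> k) - f l)) \<in> O(E)" if "f analytic_on {l}" for f
    using landau_o.big.compose[OF analytic_increment_bigo[OF that] lim_mu,
        THEN landau_o.big.norm_iff[THEN iffD2]] dE
    unfolding d_def by (rule landau_o.big_trans)
  have dM: "(\<lambda>k. norm ((M (\<mu> k) - M l) $ i $ j)) \<in> O(E)" for i j
    using incr[OF ent] by simp
  have dM': "(\<lambda>k. norm ((matrix_deriv M (\<mu> k) - matrix_deriv M l) $ i $ j)) \<in> O(E)" for i j
    using incr[OF analytic_deriv[OF ent]] by (simp add: matrix_deriv_def)
  \<comment> \<open>The entrywise Taylor remainder of \<open>M\<close> along the iterates; the part of \<open>R\<close> that acts on \<open>v\<close>.\<close>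
  define T where "T = (\<lambda>k. \<chi> i j. M (\<mu> k) $ i $ j - M l $ i $ j - matrix_deriv M l $ i $ j * d k)"
  have T: "(\<lambda>k. norm (T k $ i $ j)) \<in> O(\<lambda>k. (E k)\<^sup>2)" for i j
  proof -
    have "(\<lambda>k. norm (T k $ i $ j)) \<in> O(\<lambda>k. (norm (d k))\<^sup>2)"
      using landau_o.big.compose[OF analytic_taylor_remainder_bigo[OF ent[of i j]] lim_mu,
          THEN landau_o.big.norm_iff[THEN iffD2]]
      by (simp add: T_def d_def matrix_deriv_def norm_power)
    also have "(\<lambda>k. (norm (d k))\<^sup>2) \<in> O(\<lambda>k. (E k)\<^sup>2)"
      by (intro landau_o.big_power dE)
    finally show ?thesis .
  qed

  have R: "(\<lambda>k. norm (R k)) \<in> O(\<lambda>k. (E k)\<^sup>2)"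
  proof -
    have "(T k *v v) $ i = (M (\<mu> k) *v v - M l *v v - d k *s a) $ i" for k i
      by (simp add: T_def a_def matrix_vector_mult_def sum_subtractf sum.distrib
          sum_distrib_left algebra_simps)
    then have "T k *v v = M (\<mu> k) *v v - d k *s a" for k
      by (simp add: vec_eq_iff eig)
    then have "R k = T k *v v + (M (\<mu> k) - M l) *v e k" for k
      by (simp add: R_def e_def algebra_simps eig)
    moreover have "(\<lambda>k. norm (T k *v v)) \<in> O(\<lambda>k. (E k)\<^sup>2)"
      using matrix_vector_mult_bigo[OF T, of "\<lambda>_. v" "\<lambda>_. 1"] by simp
    moreover have "(\<lambda>k. norm ((M (\<mu> k) - M l) *v e k)) \<in> O(\<lambda>k. (E k)\<^sup>2)"
      using matrix_vector_mult_bigo[OF dM eE] by (simp add: power2_eq_square)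
    ultimately show ?thesis by (simp add: norm_add_bigo)
  qed
  have D: "(\<lambda>k. norm (D k)) \<in> O(E)"
  proof -
    have "D k = (matrix_deriv M (\<mu> k) - matrix_deriv M l) *v x k + matrix_deriv M l *v e k" for k
      by (simp add: D_def a_def e_def algebra_simps)
    moreover have "(\<lambda>k. norm (x k)) \<in> O(\<lambda>_. 1)"
      using tendsto_norm[OF lim_x] by (intro bigoI_tendsto[of _ _ "norm v"]) auto
    then have "(\<lambda>k. norm ((matrix_deriv M (\<mu> k) - matrix_deriv M l) *v x k)) \<in> O(E)"
      using matrix_vector_mult_bigo[OF dM'] by force
    moreover have "(\<lambda>k. norm (matrix_deriv M l *v e k)) \<in> O(E)"
      using matrix_vector_mult_bigo[of "\<lambda>_. matrix_deriv M l" _ "\<lambda>_. 1", OF _ eE] by simp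
    ultimately show ?thesis by (simp add: norm_add_bigo)
  qed
  have wD: "(\<lambda>k. norm (scalar_product w (D k))) \<in> O(E)"
    using scalar_product_bigo[of "\<lambda>_. w" _ "\<lambda>_. 1", OF _ D] by simp
  have wR: "(\<lambda>k. norm (scalar_product w (R k))) \<in> O(\<lambda>k. (E k)\<^sup>2)"
    using scalar_product_bigo[of "\<lambda>_. w" _ "\<lambda>_. 1", OF _ R] by simp
  have we: "(\<lambda>k. norm (scalar_product w (M l *v e k))) \<in> O(E)"
  proof -
    have "(\<lambda>k. norm (M l *v e k)) \<in> O(E)"
      using matrix_vector_mult_bigo[of "\<lambda>_. M l" _ "\<lambda>_. 1", OF _ eE] by simp
    then show ?thesis
      using scalar_product_bigo[of "\<lambda>_. w" _ "\<lambda>_. 1"] by force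
  qed
  have h_eq: "h k = scalar_product w a + scalar_product w (D k)" for k
    by (simp add: h_def D_def scalar_product_diff)
  have h_inv: "(\<lambda>k. norm (inverse (h k))) \<in> O(\<lambda>_. 1)"
  proof -
    have "(\<lambda>k. norm (scalar_product w (D k))) \<in> o(\<lambda>_. 1)"
      using E0 by (intro landau_o.big_small_trans[OF wD] smalloI_tendsto) auto
    then have "(\<lambda>k. scalar_product w (D k)) \<longlonglongrightarrow> 0"
      by (auto dest: smalloD_tendsto simp: tendsto_norm_zero_iff)
    then have "h \<longlonglongrightarrow> scalar_product w a"
      unfolding h_eq[abs_def] by (auto intro: tendsto_eq_intros)
    then have "(\<lambda>k. norm (inverse (h k))) \<longlonglongrightarrow> norm (inverse (scalar_product w a))"
      using \<alpha> by (intro tendsto_intros) auto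
    then show ?thesis by (intro bigoI_tendsto) auto
  qed

  have step: "h k \<noteq> 0"
      "d (Suc k) = d k + qn2_dmu M c \<sigma> (\<mu> k) (x k)"
      "e (Suc k) = e k - N *v qn2_z M c \<sigma> (\<mu> k) (x k)" for k
    using assms(5,7) unfolding qn2_sequence_def
    by (auto simp: h_def w_def d_def e_def N_def)
  \<comment> \<open>Multiplying \<open>\<delta>\<close> by the denominator cancels its first-order part, because
      \<open>\<alpha> w\<^sub>\<sigma>\<^sup>H a = 1\<close>; every remaining term is a product of two small factors or contains \<open>R\<close>.\<close>
  have \<delta>_eq: "\<delta> k = (d k * scalar_product w (D k) - scalar_product w (R k)
      + \<alpha> * scalar_product w (M l *v e k) * scalar_product w (D k)) * inverse (h k)" for k
  proof -
    have num: "scalar_product w (M (\<mu> k) *v x k)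
        = scalar_product w (M l *v e k) + d k * scalar_product w a + scalar_product w (R k)"
      by (simp add: R_def scalar_product_diff scalar_product_scale)
    have "\<delta> k * h k = d k * h k - scalar_product w (M (\<mu> k) *v x k)
        + \<alpha> * scalar_product w (M l *v e k) * h k"
      using step(1)[of k] unfolding \<delta>_def step(2) qn2_dmu_def
      by (simp add: h_def w_def algebra_simps)
    also have "\<dots> = d k * scalar_product w (D k) - scalar_product w (R k)
        + \<alpha> * scalar_product w (M l *v e k) * scalar_product w (D k)
        + (\<alpha> * scalar_product w a - 1) * scalar_product w (M l *v e k)"
      unfolding num h_eq by (simp add: algebra_simps)
    finally show ?thesis using step(1)[of k] \<alpha>(1) by (simp add: field_simps)
  qed
  have \<delta>: "(\<lambda>k. norm (\<delta> k)) \<in> O(\<lambda>k. (E k)\<^sup>2)"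
  proof -
    have "(\<lambda>k. norm (d k * scalar_product w (D k) - scalar_product w (R k)
      + \<alpha> * scalar_product w (M l *v e k) * scalar_product w (D k))) \<in> O(\<lambda>k. (E k)\<^sup>2)"
    proof (intro norm_add_bigo norm_diff_bigo wR)
      show "(\<lambda>k. norm (d k * scalar_product w (D k))) \<in> O(\<lambda>k. (E k)\<^sup>2)"
        using landau_o.big.mult[OF dE wD] by (simp add: norm_mult power2_eq_square)
      show "(\<lambda>k. norm (\<alpha> * scalar_product w (M l *v e k) * scalar_product w (D k))) \<in> O(\<lambda>k. (E k)\<^sup>2)"
        using landau_o.big.mult[OF we wD] \<alpha>(2) by (simp add: norm_mult power2_eq_square mult.assoc)
    qed
    from landau_o.big.mult[OF this h_inv] show ?thesis
      by (simp add: \<delta>_eq norm_mult)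
  qed
  have dmu: "(\<lambda>k. norm (qn2_dmu M c \<sigma> (\<mu> k) (x k))) \<in> O(E)"
  proof -
    have "qn2_dmu M c \<sigma> (\<mu> k) (x k) = \<delta> k - \<alpha> * scalar_product w (M l *v e k) - d k" for k
      by (simp add: \<delta>_def step(2))
    moreover have "(\<lambda>k. (E k)\<^sup>2) \<in> O(E)"
      using landau_o.big.mult[OF E1 landau_o.big_refl[of E]] by (simp add: power2_eq_square)
    then have "(\<lambda>k. norm (\<delta> k)) \<in> O(E)"
      by (rule landau_o.big_trans[OF \<delta>])
    moreover have "(\<lambda>k. norm (\<alpha> * scalar_product w (M l *v e k))) \<in> O(E)"
      using we \<alpha>(2) by (simp add: norm_mult)
    ultimately show ?thesis
      using dE by (auto intro!: norm_diff_bigo)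
  qed

  \<comment> \<open>What is left of \<open>z\<close> after removing the part that is linear in \<open>e\<close>. A first-order bound on
      \<open>\<Delta>\<mu>\<close> suffices, since it enters only multiplied by \<open>D\<close>.\<close>
  define P where "P = (\<lambda>k. qn2_dmu M c \<sigma> (\<mu> k) (x k) *s D k + \<delta> k *s a + R k)"
  have P: "(\<lambda>k. norm (N *v P k)) \<in> O(\<lambda>k. (E k)\<^sup>2)"
  proof -
    have "(\<lambda>k. norm (P k)) \<in> O(\<lambda>k. (E k)\<^sup>2)"
      unfolding P_def
    proof (intro norm_add_bigo R)
      show "(\<lambda>k. norm (qn2_dmu M c \<sigma> (\<mu> k) (x k) *s D k)) \<in> O(\<lambda>k. (E k)\<^sup>2)"
        using scalar_mult_bigo[OF dmu D] by (simp add: power2_eq_square)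
      show "(\<lambda>k. norm (\<delta> k *s a)) \<in> O(\<lambda>k. (E k)\<^sup>2)"
        using scalar_mult_bigo[OF \<delta>, of "\<lambda>_. a" "\<lambda>_. 1"] by simp
    qed
    from matrix_vector_mult_bigo[of "\<lambda>_. N" _ "\<lambda>_. 1", OF _ this] show ?thesis by simp
  qed

  have q: "q = N *v a" by (simp add: assms(10) N_def a_def)
  have NM: "N *v ((M \<sigma> - M l) *v e k) = e k - N *v (M l *v e k)" for k
    by (simp add: matrix_vector_mult_diff_rdistrib matrix_vector_mult_diff_distrib
        matrix_vector_mul_assoc inv)
  \<comment> \<open>The blocks of \<open>A2\<close> produce \<open>\<alpha> c\<^sup>H (e - N M(l) e)\<close>, which reduces to \<open>- \<alpha> w\<^sub>\<sigma>\<^sup>H M(l) e\<close>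
      because \<open>c\<^sup>H e = 0\<close>; only then do the linear parts agree.\<close>
  have remainder: "block_vec (e (Suc k)) (d (Suc k)) - A2 *v block_vec (e k) (d k)
      = block_vec (- (N *v P k)) (\<delta> k)" for k
  proof -
    have "scalar_product (\<alpha> *s (c\<^sup>H v* N v* (M \<sigma> - M l))) (e k)
        = - \<alpha> * scalar_product w (M l *v e k)"
      by (simp add: scalar_product_scale_left scalar_product_vector_matrix_mult NM
          scalar_product_diff ce wN)
    then have "d (Suc k) - scalar_product (\<alpha> *s (c\<^sup>H v* N v* (M \<sigma> - M l))) (e k) = \<delta> k"
      by (simp add: \<delta>_def)
    moreover have "((mat 1 - outer_prod (\<alpha> *s q) (c\<^sup>H)) ** N ** (M \<sigma> - M l)) *v e k
        = e k - N *v (M l *v e k) + (\<alpha> * scalar_product w (M l *v e k)) *s q"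
    proof -
      have "(mat 1 - outer_prod (\<alpha> *s q) (c\<^sup>H)) *v y = y - scalar_product (c\<^sup>H) y *s (\<alpha> *s q)" for y
        by (simp add: matrix_vector_mult_diff_rdistrib outer_prod_mult)
      then show ?thesis
        by (simp add: matrix_vector_mul_assoc[symmetric] NM scalar_product_diff ce wN vec_eq_iff)
    qed
    moreover have "qn2_z M c \<sigma> (\<mu> k) (x k)
        = P k + M l *v e k - (\<alpha> * scalar_product w (M l *v e k)) *s a"
      by (simp add: P_def D_def R_def qn2_z_def \<delta>_def step(2) vec_eq_iff algebra_simps)
    then have "e (Suc k) = e k - N *v P k - N *v (M l *v e k)
        + (\<alpha> * scalar_product w (M l *v e k)) *s q"
      by (simp add: step(3) q matrix_vector_mult_diff_distrib matrix_vector_right_distrib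
          vector_scalar_commute)
    ultimately show ?thesis
      by (simp add: assms(11) N_def[symmetric] block_mat_mult_block_vec block_vec_diff)
  qed
  have "(\<lambda>k. norm (block_vec (- (N *v P k)) (\<delta> k))) \<in> O(\<lambda>k. (E k)\<^sup>2)"
    by (rule landau_o.big_trans[OF _ sum_in_bigo(1)[OF P \<delta>]], rule bigoI[of _ 1])
       (use norm_le_norm_block_vec(3)[of "- (N *v P k)" "\<delta> k" for k] in auto)
  then show ?thesis
    unfolding remainder[symmetric] by (simp add: E_def e_def d_def)
qed

end
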